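(* Let $G$ be a finitely generated group. Then $\mathrm{rk}_S(G) = \mathrm{rk}_G(G)$ or $\mathrm{rk}_S(G) = \mathrm{rk}_G(G)+1$.
   Context: For a subset $X$ of a group $G$, $X^+$ denotes the subsemigroup of $G$ generated by $X$ (all products of one or more elements of $X$; $\emptyset^+=\emptyset$) and $\langle X\rangle$ the subgroup generated by $X$. A group is finitely generated as a group if and only if it is finitely generated as a semigroup. For a finitely generated group $G$, the semigroup rank is $\mathrm{rk}_S(G)=\min\{|X| : X\subseteq G,\ X^+=G\}$ and the group rank is $\mathrm{rk}_G(G)=\min\{|X| : X\subseteq G,\ \langle X\rangle=G\}$. *)

theory Defs
  imports "HOL-Algebra.Generated_Groups"
begin

inductive_set subsemigroup_gen :: "('a, 'b) monoid_scheme \<Rightarrow> 'a set \<Rightarrow> 'a set"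
  for G and X where
    incl: "x \<in> X \<Longrightarrow> x \<in> subsemigroup_gen G X"
  | mult: "x \<in> subsemigroup_gen G X \<Longrightarrow> y \<in> subsemigroup_gen G X
             \<Longrightarrow> x \<otimes>\<^bsub>G\<^esub> y \<in> subsemigroup_gen G X"

definition finitely_generated_group :: "('a, 'b) monoid_scheme \<Rightarrow> bool" where
  "finitely_generated_group G \<longleftrightarrow>
     group G \<and> (\<exists>X. X \<subseteq> carrier G \<and> finite X \<and> generate G X = carrier G)"

(* In both ranks, finiteness of X is required explicitly because card X = 0 for infinite X;
   the minimum is intended for finitely generated groups only. *)

definition semigroup_rank :: "('a, 'b) monoid_scheme \<Rightarrow> nat" where
  "semigroup_rank G =
     (LEAST n. \<exists>X. X \<subseteq> carrier G \<and> finite X \<and> card X = n \<and> subsemigroup_gen G X = carrier G)"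

definition group_rank :: "('a, 'b) monoid_scheme \<Rightarrow> nat" where
  "group_rank G =
     (LEAST n. \<exists>X. X \<subseteq> carrier G \<and> finite X \<and> card X = n \<and> generate G X = carrier G)"

end

(* Adjoining the inverse of the product of all generators turns a group generating set into a
   semigroup generating set; this inverse is built up one generator at a time.  Conversely, a set
   that generates G as a semigroup also generates it as a group. *)
theory Submission
  imports Defs
begin

lemma subsemigroup_gen_least:
  assumes "X \<subseteq> S" "\<And>x y. x \<in> S \<Longrightarrow> y \<in> S \<Longrightarrow> x \<otimes>\<^bsub>G\<^esub> y \<in> S"
  shows "subsemigroup_gen G X \<subseteq> S"
proof
  fix x assume "x \<in> subsemigroup_gen G X"
  then show "x \<in> S" by induction (use assms in auto)
qed

lemma subsemigroup_gen_subset_generate: "subsemigroup_gen G X \<subseteq> generate G X"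
  by (rule subsemigroup_gen_least) (auto intro: generate.incl generate.eng)

text \<open>Source of the upper bound on \<open>semigroup_rank\<close>. The target is
  \<open>generate G X\<close>, not the whole carrier, so that induction on \<open>X\<close> applies:
  the new witness is chosen so that the old one can be recovered from it.\<close>

lemma (in group) ex_subsemigroup_gen_insert_eq_generate:
  assumes "finite X" "X \<subseteq> carrier G"
  shows "\<exists>z\<in>generate G X. subsemigroup_gen G (insert z X) = generate G X"
  using assms
proof (induction X)
  case empty
  \<comment> \<open>The empty set generates the trivial subgroup but an empty subsemigroup, so the
    empty product \<one> serves as witness.\<close>
  have "subsemigroup_gen G {\<one>} = {\<one>}"
    using subsemigroup_gen_least[of "{\<one>}" "{\<one>}" G] by (auto intro: subsemigroup_gen.incl)
  then show ?case by (simp add: generate_empty)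
next
  case (insert x X)
  then have x: "x \<in> carrier G" and X: "X \<subseteq> carrier G" by auto
  from insert.IH[OF X] obtain z where z: "z \<in> generate G X"
    and gen: "subsemigroup_gen G (insert z X) = generate G X" by blast
  have zG: "z \<in> carrier G" using generate_in_carrier[OF X z] .
  \<comment> \<open>If \<open>z\<close> inverts a product p, then \<open>w\<close> inverts
    \<open>x \<otimes> p\<close>. Cancelling \<open>x\<close> on the right of \<open>w\<close> gives
    back \<open>z\<close>, and cancelling \<open>z\<close> on the left leaves
    \<open>inv x\<close>.\<close>
  define w where "w = z \<otimes> inv x"
  define S where "S = subsemigroup_gen G (insert w (insert x X))"
  have S_mult: "a \<otimes> b \<in> S" if "a \<in> S" "b \<in> S" for a b
    using that unfolding S_def by (rule subsemigroup_gen.mult)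
  have S_incl: "w \<in> S" "x \<in> S" "X \<subseteq> S" unfolding S_def by (auto intro: subsemigroup_gen.incl)
  have "w \<otimes> x = z" using x zG by (simp add: w_def m_assoc)
  with S_mult[OF S_incl(1,2)] have "z \<in> S" by simp
  with S_incl(3) S_mult gen have genX: "generate G X \<subseteq> S"
    using subsemigroup_gen_least[of "insert z X" S G] by simp
  \<comment> \<open>\<open>S\<close> is not yet known to be closed under inverses, but it contains
    the subgroup \<open>generate G X\<close>, which is.\<close>
  have "inv z \<in> S" using genX generate_m_inv_closed[OF X z] by blast
  moreover have "inv z \<otimes> w = inv x" using x zG by (simp add: w_def m_assoc[symmetric])
  ultimately have inv_x: "inv x \<in> S" using S_mult[of "inv z" w] S_incl(1) by simp
  have "generate G (insert x X) \<subseteq> S"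
  proof
    fix g assume "g \<in> generate G (insert x X)"
    then show "g \<in> S"
    proof induction
      case one
      show ?case using genX generate.one by blast
    next
      case (incl h)
      then show ?case using S_incl by blast
    next
      case (inv h)
      \<comment> \<open>Either \<open>h\<close> is the new generator \<open>x\<close>, or its
        inverse already lies in \<open>generate G X\<close>.\<close>
      then show ?case using inv_x genX generate.inv[of h X G] by blast
    next
      case (eng h1 h2)
      then show ?case by (blast intro: S_mult)
    qed
  qed
  moreover have w: "w \<in> generate G (insert x X)"
    unfolding w_def using z mono_generate[of X "insert x X"]
    by (blast intro: generate.eng generate.inv)
  moreover have "S \<subseteq> generate G (insert x X)"
    unfolding S_def by (rule subsemigroup_gen_least) (use w in \<open>auto intro: generate.incl generate.eng\<close>)
  ultimately show ?case unfolding S_def by blast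
qed

theorem corollary2p4:
  fixes G :: "('a, 'b) monoid_scheme"
  assumes "finitely_generated_group G"
  shows "semigroup_rank G = group_rank G \<or> semigroup_rank G = group_rank G + 1"
proof -
  interpret group G using assms by (simp add: finitely_generated_group_def)
  let ?R = "\<lambda>gen n. \<exists>X. X \<subseteq> carrier G \<and> finite X \<and> card X = n \<and> gen X = carrier G"
  have "\<exists>n. ?R (generate G) n" using assms unfolding finitely_generated_group_def by blast
  then have "?R (generate G) (group_rank G)" unfolding group_rank_def by (rule LeastI_ex)
  then obtain X where X: "X \<subseteq> carrier G" "finite X" "card X = group_rank G"
    "generate G X = carrier G" by blast
  then obtain z where "z \<in> carrier G" "subsemigroup_gen G (insert z X) = carrier G"
    using ex_subsemigroup_gen_insert_eq_generate[of X] by auto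
  with X have R: "?R (subsemigroup_gen G) (card (insert z X))"
    by (intro exI[of _ "insert z X"]) auto
  then have "semigroup_rank G \<le> card (insert z X)"
    unfolding semigroup_rank_def by (rule Least_le)
  \<comment> \<open>Only an inequality, since \<open>z\<close> may already belong to
    \<open>X\<close>.\<close>
  also have "\<dots> \<le> group_rank G + 1" using X by (simp add: card_insert_if)
  finally have upper: "semigroup_rank G \<le> group_rank G + 1" .
  \<comment> \<open>\<open>R\<close> has a second use: it shows that some finite semigroup
    generating set exists, so the minimum is attained.\<close>
  from R have "?R (subsemigroup_gen G) (semigroup_rank G)"
    unfolding semigroup_rank_def by (rule LeastI)
  then obtain Y where Y: "Y \<subseteq> carrier G" "finite Y" "card Y = semigroup_rank G"
    "subsemigroup_gen G Y = carrier G" by blast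
  \<comment> \<open>The generated subgroup lies between the subsemigroup, here all of
    \<open>G\<close>, and the carrier.\<close>
  then have "generate G Y = carrier G"
    using subsemigroup_gen_subset_generate[of G Y] generate_incl[of Y] by auto
  with Y have "?R (generate G) (semigroup_rank G)" by blast
  then have "group_rank G \<le> semigroup_rank G" unfolding group_rank_def by (rule Least_le)
  with upper show ?thesis by linarith
qed

end
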